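(* Let $T : G \curvearrowright (X, \mu)$ be a measure-preserving action of a discrete group $G$ on a probability space $(X, \mu)$, and let $(C_k)_{k=1}^\infty$ be a sequence of measurable subsets of $X$ such that $\mu(C_k) \to 1$. Let $(F_k)_{k=1}^\infty$ be a sequence of nonempty finite subsets of $G$. Then $$\lim_{k \to \infty} \alpha_{C_k}\left( \operatorname{Avg}_{F_k} f \right) = \int f \, \mathrm{d}\mu$$ for all $f \in L^\infty(X, \mu)$.
   Context: For a nonempty finite $K \subseteq G$, $\operatorname{Avg}_K f = \frac{1}{|K|} \sum_{g \in K} f \circ T_g$. For a measurable $C \subseteq X$ with $\mu(C)>0$ and $h \in L^1(X,\mu)$, $\alpha_C(h) = \frac{1}{\mu(C)} \int_C h \, \mathrm{d}\mu$; in the claim $\alpha_{C_k}$ is thus defined for all sufficiently large $k$. *)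

theory Defs
  imports "HOL-Probability.Probability_Measure" "HOL-Algebra.Group_Action"
begin

text \<open>
  The library's \<^const>\<open>group_action\<close> asks for a homomorphism from \<open>G\<close> into the group of bijections
  of \<^term>\<open>space M\<close>, so \<open>T (g \<otimes> h) = T g \<circ> T h\<close> holds everywhere on the space and not merely almost
  everywhere. The group carries no topology and may be uncountable.
\<close>

definition measure_preserving_action ::
  "('g, 'c) monoid_scheme \<Rightarrow> 'x measure \<Rightarrow> ('g \<Rightarrow> 'x \<Rightarrow> 'x) \<Rightarrow> bool" where
  "measure_preserving_action G M T \<longleftrightarrow>
     group_action G (space M) T \<and>
     (\<forall>g\<in>carrier G. T g \<in> measurable M M \<and> distr M M (T g) = M)"

text \<open>Representatives of the elements of complex \<open>L\<^sup>\<infinity>(M)\<close>, not identified modulo null sets.\<close>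

definition L_infinity :: "'x measure \<Rightarrow> ('x \<Rightarrow> complex) set" where
  "L_infinity M = {f \<in> borel_measurable M. \<exists>B::real. AE x in M. norm (f x) \<le> B}"

definition Avg :: "('g \<Rightarrow> 'x \<Rightarrow> 'x) \<Rightarrow> 'g set \<Rightarrow> ('x \<Rightarrow> complex) \<Rightarrow> 'x \<Rightarrow> complex" where
  "Avg T K f = (\<lambda>x. (1 / of_nat (card K)) * (\<Sum>g\<in>K. (f \<circ> T g) x))"

text \<open>Only meaningful for \<open>\<mu>(C) > 0\<close>; on null sets \<open>alpha\<close> takes the junk value 0.\<close>

definition alpha :: "'x measure \<Rightarrow> 'x set \<Rightarrow> ('x \<Rightarrow> complex) \<Rightarrow> complex" where
  "alpha M C h = (1 / of_real (measure M C)) * (LINT x:C|M. h x)"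

end

theory Submission
  imports Defs
begin

text \<open>
  Since \<open>T\<close> preserves the measure, every average \<open>h\<close> of \<open>f\<close> has the same integral and the same
  almost sure bound \<open>B\<close> as \<open>f\<close>. Discarding the complement of \<open>C\<close> therefore changes the integral of
  \<open>h\<close> by at most \<open>B (1 - \<mu>(C))\<close>, uniformly over all averages, and this tends to 0.
\<close>

lemma (in prob_space) norm_set_integral_diff_le:
  fixes h :: "'a \<Rightarrow> 'b::{banach, second_countable_topology}"
  assumes h: "integrable M h" and B: "AE x in M. norm (h x) \<le> B" and C: "C \<in> sets M"
  shows "norm ((LINT x:C|M. h x) - (LINT x|M. h x)) \<le> B * (1 - prob C)"
proof -
  have iC: "integrable M (\<lambda>x. indicator C x *\<^sub>R h x)"
    using integrable_mult_indicator[OF C h] .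
  have iB: "integrable M (\<lambda>x. B * (1 - indicator C x))"
    using C by (intro integrable_mult_right Bochner_Integration.integrable_diff) (auto simp: less_top[symmetric])
  have "(LINT x:C|M. h x) - (LINT x|M. h x) = (LINT x|M. indicator C x *\<^sub>R h x - h x)"
    using iC h by (simp add: set_lebesgue_integral_def)
  also have "norm \<dots> \<le> (LINT x|M. norm (indicator C x *\<^sub>R h x - h x))"
    by (rule integral_norm_bound)
  \<comment> \<open>The integrand vanishes on \<open>C\<close> and equals \<open>- h x\<close> off
    \<open>C\<close>, so it is dominated almost surely by \<open>B\<close> times the indicator of
    the complement, here written \<open>1 - indicator C x\<close>.\<close>
  also have "\<dots> \<le> (LINT x|M. B * (1 - indicator C x))"
    using B by (intro integral_mono_AE integrable_norm Bochner_Integration.integrable_diff iC h iB)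
      (auto simp: indicator_def)
  also have "\<dots> = B * (1 - prob C)"
    using C by (subst integral_mult_right_zero, subst Bochner_Integration.integral_diff)
      (auto simp: less_top[symmetric] prob_space)
  finally show ?thesis .
qed

lemma (in prob_space) L_infinity_integrable:
  assumes "f \<in> L_infinity M"
  shows "integrable M f"
  using assms integrable_const_bound unfolding L_infinity_def by blast

text \<open>Change of variables along \<open>distr M M (T g) = M\<close> gives all summands
  \<open>f \<circ> T g\<close> the integral of \<open>f\<close>; since \<open>K\<close> is finite
  and nonempty, \<open>card K\<close> equal terms cancel the factor
  \<open>1 / card K\<close>.\<close>

lemma integral_Avg:
  assumes T: "\<And>g. g \<in> K \<Longrightarrow> T g \<in> measurable M M \<and> distr M M (T g) = M"
    and K: "finite K" "K \<noteq> {}"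
    and f: "integrable M f"
  shows "integrable M (Avg T K f)" and "(LINT x|M. Avg T K f x) = (LINT x|M. f x)"
proof -
  have i: "integrable M (\<lambda>x. f (T g x))" and e: "(LINT x|M. f (T g x)) = (LINT x|M. f x)"
    if "g \<in> K" for g
    using T[OF that] f integrable_distr[of "T g" M M f]
      integral_distr[of "T g" M M f] borel_measurable_integrable[OF f] by auto
  show "integrable M (Avg T K f)"
    unfolding Avg_def using i by (simp add: comp_def)
  show "(LINT x|M. Avg T K f x) = (LINT x|M. f x)"
    unfolding Avg_def using i e K by (simp add: comp_def)
qed

text \<open>Measure preservation makes the preimage under \<open>T g\<close> of the exceptional null
  set null again. Finitely many such sets have a null union, and off it the triangle inequality
  bounds the average.\<close>

lemma AE_norm_Avg_le:
  assumes T: "\<And>g. g \<in> K \<Longrightarrow> T g \<in> measurable M M \<and> distr M M (T g) = M"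
    and K: "finite K" "K \<noteq> {}"
    and f: "f \<in> borel_measurable M" and B: "AE x in M. norm (f x) \<le> B"
  shows "AE x in M. norm (Avg T K f x) \<le> B"
proof -
  have "AE x in M. norm (f (T g x)) \<le> B" if "g \<in> K" for g
  proof -
    \<comment> \<open>Reading \<open>M\<close> as the image measure under \<open>T g\<close> lets
      \<open>AE_distr_iff\<close> pull the bound back along \<open>T g\<close>.\<close>
    have "AE x in distr M M (T g). norm (f x) \<le> B"
      using T[OF that] B by metis
    then show ?thesis
      using T[OF that] f by (simp add: AE_distr_iff)
  qed
  then have "AE x in M. \<forall>g\<in>K. norm (f (T g x)) \<le> B"
    using K by (simp add: AE_finite_all)
  then show ?thesis
  proof eventually_elim
    case (elim x)
    have "norm (\<Sum>g\<in>K. f (T g x)) \<le> of_nat (card K) * B"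
      using elim by (intro sum_norm_bound) auto
    then show ?case
      using K by (simp add: Avg_def norm_divide divide_le_eq card_gt_0_iff mult.commute)
  qed
qed

theorem proposition2p3:
  fixes G :: "('g, 'c) monoid_scheme"
    and M :: "'x measure"
    and T :: "'g \<Rightarrow> 'x \<Rightarrow> 'x"
    and C :: "nat \<Rightarrow> 'x set"
    and F :: "nat \<Rightarrow> 'g set"
  assumes "prob_space M"
    and "measure_preserving_action G M T"
    and "\<And>k. k \<ge> 1 \<Longrightarrow> C k \<in> sets M"
    and "(\<lambda>k. measure M (C k)) \<longlonglongrightarrow> 1"
    and "\<And>k. k \<ge> 1 \<Longrightarrow> finite (F k) \<and> F k \<noteq> {} \<and> F k \<subseteq> carrier G"
  shows "\<forall>f \<in> L_infinity M.
           (\<lambda>k. alpha M (C k) (Avg T (F k) f)) \<longlonglongrightarrow> (LINT x|M. f x)"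
proof
  fix f assume f: "f \<in> L_infinity M"
  interpret prob_space M by fact
  from f obtain B where fm: "f \<in> borel_measurable M" and B: "AE x in M. norm (f x) \<le> B"
    unfolding L_infinity_def by auto
  let ?I = "LINT x|M. f x"
  let ?J = "\<lambda>k. LINT x:C k|M. Avg T (F k) f x"
  have T: "T g \<in> measurable M M \<and> distr M M (T g) = M" if "k \<ge> 1" "g \<in> F k" for k g
    using assms(2) assms(5)[OF that(1)] that(2) unfolding measure_preserving_action_def by blast
  \<comment> \<open>The constant \<open>B\<close> was fixed from \<open>f\<close> alone, so it
    serves all \<open>k\<close> at once, whatever the sets \<open>F k\<close> are.\<close>
  have bound: "norm (?J k - ?I) \<le> B * (1 - prob (C k))" if k: "k \<ge> 1" for k
  proof -
    have K: "finite (F k)" "F k \<noteq> {}" using assms(5)[OF k] by auto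
    note Tk = T[OF k]
    note avg = integral_Avg[OF Tk K L_infinity_integrable[OF f]]
    show ?thesis
      using norm_set_integral_diff_le[OF avg(1) AE_norm_Avg_le[OF Tk K fm B] assms(3)[OF k]]
      by (simp add: avg(2))
  qed
  have "(\<lambda>k. B * (1 - prob (C k))) \<longlonglongrightarrow> 0"
    using tendsto_mult[OF tendsto_const[of B] tendsto_diff[OF tendsto_const[of 1] assms(4)]] by simp
  \<comment> \<open>Nothing is known at index 0, but the comparison needs the bound only
    eventually.\<close>
  then have "(\<lambda>k. ?J k - ?I) \<longlonglongrightarrow> 0"
    by (rule Lim_null_comparison[rotated]) (use bound in \<open>auto simp: eventually_sequentially\<close>)
  then have "?J \<longlonglongrightarrow> ?I"
    by (rule LIM_zero_cancel)
  \<comment> \<open>Inversion is continuous at the nonzero limit 1. Indices with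
    \<open>prob (C k) = 0\<close>, where division yields 0, are finitely many and do not affect the
    limit.\<close>
  moreover have "(\<lambda>k. 1 / complex_of_real (prob (C k))) \<longlonglongrightarrow> 1 / complex_of_real 1"
    by (intro tendsto_intros assms(4)) simp
  ultimately show "(\<lambda>k. alpha M (C k) (Avg T (F k) f)) \<longlonglongrightarrow> ?I"
    unfolding alpha_def using tendsto_mult by fastforce
qed

end
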